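(* Let $n\ge 2$ and let two mirrors form a spherical periscope with centre $O$ (the origin of $\mathbb{R}^n$), with associated local diffeomorphism $T: x\mapsto y$ of the unit sphere $S^{n-1}$, defined on an open set $W\subset S^{n-1}$. Assume that $T(x)\neq -x$ for all $x\in W$, and let $V_T$ be the associated unit tangent vector field on $W$. Then $V_T$ is projectively gradient.
   Context: Spherical periscope: let $O$ be the origin of $\mathbb{R}^n$ and $S^{n-1}$ the unit sphere centred at $O$. A spherical periscope is a system of two mirrors (smooth hypersurfaces) such that every ray emanating from $O$ in a direction $x$ in some (connected) open set $W\subset S^{n-1}$ reflects consecutively in the two mirrors and returns to $O$. The mirrors are described by smooth radial functions: there are smooth functions $f:W\to\mathbb{R}$ and $g:T(W)\to\mathbb{R}$ such that the first mirror is $\{P(x)=e^{f(x)}x : x\in W\}$ and the second is $\{Q(y)=e^{g(y)}y : y\in T(W)\}$, where $T:W\to T(W)\subset S^{n-1}$ is a diffeomorphism onto an open set. For each $x\in W$ and $y=T(x)$: $P=P(x)\ne Q=Q(y)$; the ray from $O$ in direction $x$ hits the first mirror at $P$ and reflects to the ray directed along $u=(Q-P)/|Q-P|$, i.e. $u$ is the image of $x$ under the linear reflection in the tangent hyperplane of the first mirror at $P$; this ray hits the second mirror at $Q$ and reflects to the ray from $Q$ back to $O$, i.e. $-y$ is the image of $u$ under the linear reflection in the tangent hyperplane of the second mirror at $Q$. The field $V_T$: for a local diffeomorphism $T$ of the sphere that takes no point to its antipode, connect $x$ with $T(x)$ by the shortest geodesic arc of $S^{n-1}$; $V_T(x)\in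 T_xS^{n-1}$ is the unit tangent vector to this arc at $x$ (pointing towards $T(x)$). A vector field $V$ on a Riemannian manifold is called projectively gradient if it is proportional to a gradient vector field with a functional factor, i.e. $V=\lambda\,\nabla F$ for some functions $\lambda$ and $F$ on its domain. Here the sphere (and its open subsets) carries the standard round metric. *)

theory Defs
  imports "HOL-Analysis.Analysis"
begin

text \<open>
  \<open>Ck_on\<close> and \<open>smooth_on\<close> are meant for open sets \<open>U\<close> only. Smoothness on an arbitrary subset of a
  Euclidean space, such as a relatively open subset of the sphere, is \<open>smooth_map_on\<close>: locally a
  restriction of a smooth function defined on an open subset of the ambient space.
\<close>

fun Ck_on :: "nat \<Rightarrow> 'a::euclidean_space set \<Rightarrow> ('a \<Rightarrow> 'b::real_normed_vector) \<Rightarrow> bool" where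
  "Ck_on 0 U f \<longleftrightarrow> continuous_on U f"
| "Ck_on (Suc k) U f \<longleftrightarrow>
     (\<forall>x\<in>U. f differentiable (at x)) \<and>
     (\<forall>v. Ck_on k U (\<lambda>x. frechet_derivative f (at x) v))"

definition smooth_on :: "'a::euclidean_space set \<Rightarrow> ('a \<Rightarrow> 'b::real_normed_vector) \<Rightarrow> bool" where
  "smooth_on U f \<longleftrightarrow> (\<forall>k. Ck_on k U f)"

definition smooth_map_on :: "'a::euclidean_space set \<Rightarrow> ('a \<Rightarrow> 'b::real_normed_vector) \<Rightarrow> bool" where
  "smooth_map_on S f \<longleftrightarrow>
     (\<forall>x\<in>S. \<exists>U F. open U \<and> x \<in> U \<and> smooth_on U F \<and> (\<forall>z\<in>S \<inter> U. F z = f z))"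

definition open_in_sphere :: "'a::euclidean_space set \<Rightarrow> bool" where
  "open_in_sphere W \<longleftrightarrow> openin (top_of_set (sphere 0 1)) W"

definition sphere_diffeo :: "'a::euclidean_space set \<Rightarrow> ('a \<Rightarrow> 'a) \<Rightarrow> bool" where
  "sphere_diffeo W T \<longleftrightarrow>
     open_in_sphere W \<and> open_in_sphere (T ` W) \<and> inj_on T W \<and>
     smooth_map_on W T \<and> smooth_map_on (T ` W) (inv_into W T)"

text \<open>
  The tangent space, as a linear subspace, of an embedded submanifold \<open>M\<close> at \<open>p\<close>: the velocities
  at \<open>p\<close> of curves in \<open>M\<close> through \<open>p\<close>.
\<close>

definition tangent_space :: "'a::euclidean_space set \<Rightarrow> 'a \<Rightarrow> 'a set" where
  "tangent_space M p =
     {v. \<exists>\<gamma> e. 0 < e \<and> \<gamma> ` {-e<..<e} \<subseteq> M \<and> \<gamma> 0 = p \<and> (\<gamma> has_vector_derivative v) (at (0::real))}"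

text \<open>
  On a linear subspace \<open>H\<close>, \<open>closest_point H\<close> is the orthogonal projection onto \<open>H\<close>, so the
  following is the linear reflection in \<open>H\<close>.
\<close>

definition reflect_across :: "'a::euclidean_space set \<Rightarrow> 'a \<Rightarrow> 'a" where
  "reflect_across H v = 2 *\<^sub>R closest_point H v - v"

definition mirror_point :: "('a::euclidean_space \<Rightarrow> real) \<Rightarrow> 'a \<Rightarrow> 'a" where
  "mirror_point f x = exp (f x) *\<^sub>R x"

definition spherical_periscope ::
    "'a::euclidean_space set \<Rightarrow> ('a \<Rightarrow> 'a) \<Rightarrow> ('a \<Rightarrow> real) \<Rightarrow> ('a \<Rightarrow> real) \<Rightarrow> bool" where
  "spherical_periscope W T f g \<longleftrightarrow>
     connected W \<and> sphere_diffeo W T \<and> smooth_map_on W f \<and> smooth_map_on (T ` W) g \<and>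
     (\<forall>x\<in>W.
        let M\<^sub>1 = mirror_point f ` W; M\<^sub>2 = mirror_point g ` (T ` W);
            P = mirror_point f x; Q = mirror_point g (T x);
            u = (Q - P) /\<^sub>R norm (Q - P)
        in P \<noteq> Q \<and>
           u = reflect_across (tangent_space M\<^sub>1 P) x \<and>
           - T x = reflect_across (tangent_space M\<^sub>2 Q) u)"

text \<open>
  For a unit tangent vector \<open>v\<close> at \<open>x\<close>, the map \<open>t \<mapsto> cos t *\<^sub>R x + sin t *\<^sub>R v\<close> is the unit-speed
  geodesic of the sphere with initial velocity \<open>v\<close>. It is the shortest arc to each of its points
  with \<open>0 < t < pi\<close>. The value at \<open>x\<close> is meaningful only if \<open>T x \<noteq> x\<close> and \<open>T x \<noteq> - x\<close>.
\<close>

definition geodesic_direction :: "('a::euclidean_space \<Rightarrow> 'a) \<Rightarrow> 'a \<Rightarrow> 'a" where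
  "geodesic_direction T x =
     (THE v. norm v = 1 \<and> v \<bullet> x = 0 \<and> (\<exists>t\<in>{0<..<pi}. T x = cos t *\<^sub>R x + sin t *\<^sub>R v))"

text \<open>
  The gradient for the round metric, where \<open>W\<close> is open in the sphere and \<open>x \<in> W\<close>: the vector tangent
  to the sphere at \<open>x\<close> that represents the differential of \<open>F\<close>. A derivative within \<open>W\<close> is only
  determined on the tangent space of the sphere; \<open>G \<bullet> x = 0\<close> makes \<open>G\<close> unique.
\<close>

definition sphere_gradient :: "'a::euclidean_space set \<Rightarrow> ('a \<Rightarrow> real) \<Rightarrow> 'a \<Rightarrow> 'a" where
  "sphere_gradient W F x =
     (THE G. G \<bullet> x = 0 \<and> (F has_derivative (\<lambda>h. G \<bullet> h)) (at x within W))"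

definition projectively_gradient :: "'a::euclidean_space set \<Rightarrow> ('a \<Rightarrow> 'a) \<Rightarrow> bool" where
  "projectively_gradient W V \<longleftrightarrow>
     (\<exists>\<mu> F. smooth_map_on W \<mu> \<and> smooth_map_on W F \<and>
            (\<forall>x\<in>W. V x = \<mu> x *\<^sub>R sphere_gradient W F x))"

end

theory Submission
  imports Defs
begin

text \<open>
  The direction field is the normalised gradient of the logarithmic radius \<open>f\<close> of the first mirror,
  so \<open>f\<close> itself serves as the potential.

  Let \<open>x \<in> W\<close>, \<open>y = T x\<close>, and let \<open>G\<close> be the spherical gradient of \<open>f\<close> at \<open>x\<close>. The first mirror is a
  radial graph over \<open>W\<close>, and its tangent space at \<open>P\<close> is the hyperplane orthogonal to \<open>x - G\<close>
  (\<open>tangent_space_radial_mirror\<close>). Hence the ray reflected at \<open>P\<close> has the direction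
  \<open>u = x - (2 / (1 + G \<bullet> G)) *\<^sub>R (x - G)\<close>, and the component of \<open>u\<close> orthogonal to \<open>x\<close> is a positive
  multiple of \<open>G\<close>. On the other hand \<open>u\<close> is a positive multiple of \<open>Q - P\<close>, where \<open>P\<close> is a multiple of
  \<open>x\<close> and \<open>Q\<close> is a positive multiple of \<open>y\<close>; so the same component is a positive multiple of
  \<open>y - (y \<bullet> x) *\<^sub>R x\<close>, which points along the shortest arc from \<open>x\<close> to \<open>y\<close>. Therefore the direction
  field is \<open>sgn G\<close> (\<open>geodesic_direction_eq_sgn_gradient\<close>).

  This presupposes \<open>y \<noteq> x\<close>. If \<open>y = x\<close>, then \<open>P\<close> and \<open>Q\<close> lie on one ray from the origin and \<open>u\<close> is \<open>x\<close>
  or \<open>- x\<close>. In the first case \<open>x\<close> would be fixed by the reflection at \<open>P\<close>, in the second case \<open>- x\<close> would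
  be fixed by the reflection at \<open>Q\<close>. Both are impossible because a tangent hyperplane of a radial
  graph never contains the radial direction (\<open>reflect_across_radial_mirror_neq\<close>).

  The factor is thus \<open>1 / norm G\<close>. It is smooth because \<open>norm G\<close> has no zero, and because \<open>(norm G)\<^sup>2\<close> is
  a polynomial in the coordinates and in the partial derivatives of any local smooth extension of
  \<open>f\<close> to the ambient space (\<open>smooth_map_on_inverse_norm_gradient\<close>).
\<close>

section \<open>Closure of smooth real functions under algebraic operations\<close>

lemma Ck_on_SucD:
  assumes "Ck_on (Suc k) U f"
  shows "Ck_on k U f"
  using assms
proof (induction k arbitrary: f)
  case 0
  then show ?case
    by (auto intro!: continuous_at_imp_continuous_on differentiable_imp_continuous_within)
next
  case (Suc k)
  then show ?case by (metis Ck_on.simps(2))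
qed

lemma Ck_on_subset: "Ck_on k U f \<Longrightarrow> V \<subseteq> U \<Longrightarrow> Ck_on k V f"
  by (induction k arbitrary: f) (auto intro: continuous_on_subset)

lemma frechet_derivative_cong_on_open:
  assumes "open U" "x \<in> U" "\<And>z. z \<in> U \<Longrightarrow> f z = g z"
  shows "frechet_derivative f (at x) = frechet_derivative g (at x)"
proof -
  have "(f has_derivative f') (at x) \<longleftrightarrow> (g has_derivative f') (at x)" for f'
    using assms by (metis has_derivative_transform_within_open)
  then show ?thesis unfolding frechet_derivative_def by simp
qed

lemma Ck_on_cong:
  assumes "open U" "Ck_on k U f" "\<And>z. z \<in> U \<Longrightarrow> f z = g z"
  shows "Ck_on k U g"
  using assms(2,3)
proof (induction k arbitrary: f g)
  case 0
  then show ?case by (simp cong: continuous_on_cong)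
next
  case (Suc k)
  have "g differentiable (at x)" if "x \<in> U" for x
    using Suc.prems that assms(1) unfolding differentiable_def Ck_on.simps
    by (metis has_derivative_transform_within_open)
  moreover have "Ck_on k U (\<lambda>x. frechet_derivative g (at x) v)" for v
  proof (rule Suc.IH)
    show "Ck_on k U (\<lambda>x. frechet_derivative f (at x) v)"
      using Suc.prems by simp
    show "frechet_derivative f (at z) v = frechet_derivative g (at z) v" if "z \<in> U" for z
      using frechet_derivative_cong_on_open[OF assms(1) that Suc.prems(2)] by simp
  qed
  ultimately show ?case by simp
qed

lemma Ck_on_SucI:
  assumes "open U"
    and "\<And>x. x \<in> U \<Longrightarrow> (f has_derivative D x) (at x)"
    and "\<And>v. Ck_on k U (\<lambda>x. D x v)"
  shows "Ck_on (Suc k) U f"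
proof -
  have "Ck_on k U (\<lambda>x. frechet_derivative f (at x) v)" for v
    by (rule Ck_on_cong[OF assms(1) assms(3)[of v]])
       (simp add: frechet_derivative_at[OF assms(2)])
  then show ?thesis using assms(2) by (auto simp: differentiable_def)
qed

lemma Ck_on_const: "Ck_on k U (\<lambda>x. c)"
  by (induction k arbitrary: c) auto

lemma Ck_on_bounded_linear:
  assumes "open U" "bounded_linear L"
  shows "Ck_on k U L"
proof (cases k)
  case 0
  then show ?thesis using assms linear_continuous_on by auto
next
  case (Suc k')
  show ?thesis unfolding Suc
    by (rule Ck_on_SucI[where D = "\<lambda>_. L"])
       (use assms in \<open>auto intro: bounded_linear_imp_has_derivative Ck_on_const\<close>)
qed

lemma Ck_on_has_derivative:
  assumes "Ck_on (Suc k) U f" "x \<in> U"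
  shows "(f has_derivative frechet_derivative f (at x)) (at x)"
  using assms by (simp add: frechet_derivative_works)

lemma Ck_on_add:
  assumes "open U" "Ck_on k U f" "Ck_on k U g"
  shows "Ck_on k U (\<lambda>x. f x + g x)"
  using assms(2,3)
proof (induction k arbitrary: f g)
  case 0
  then show ?case by (auto intro: continuous_intros)
next
  case (Suc k)
  show ?case
  proof (rule Ck_on_SucI[OF assms(1)])
    fix x assume "x \<in> U"
    then show "((\<lambda>x. f x + g x) has_derivative
        (\<lambda>v. frechet_derivative f (at x) v + frechet_derivative g (at x) v)) (at x)"
      using Suc.prems by (intro has_derivative_add Ck_on_has_derivative)
  next
    fix v
    show "Ck_on k U (\<lambda>x. frechet_derivative f (at x) v + frechet_derivative g (at x) v)"
      using Suc.prems by (intro Suc.IH) auto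
  qed
qed

lemma Ck_on_mult:
  fixes f g :: "'a::euclidean_space \<Rightarrow> real"
  assumes "open U" "Ck_on k U f" "Ck_on k U g"
  shows "Ck_on k U (\<lambda>x. f x * g x)"
  using assms(2,3)
proof (induction k arbitrary: f g)
  case 0
  then show ?case by (auto intro: continuous_intros)
next
  case (Suc k)
  show ?case
  proof (rule Ck_on_SucI[OF assms(1)])
    fix x assume "x \<in> U"
    then show "((\<lambda>x. f x * g x) has_derivative
        (\<lambda>v. f x * frechet_derivative g (at x) v + frechet_derivative f (at x) v * g x)) (at x)"
      using Suc.prems by (intro has_derivative_mult Ck_on_has_derivative)
  next
    fix v
    show "Ck_on k U
        (\<lambda>x. f x * frechet_derivative g (at x) v + frechet_derivative f (at x) v * g x)"
      using Suc.prems Ck_on_SucD[OF Suc.prems(1)] Ck_on_SucD[OF Suc.prems(2)]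
      by (intro Ck_on_add[OF assms(1)] Suc.IH) simp_all
  qed
qed

lemma Ck_on_sum:
  assumes "open U" "\<And>i. i \<in> I \<Longrightarrow> Ck_on k U (f i)"
  shows "Ck_on k U (\<lambda>x. \<Sum>i\<in>I. f i x)"
  using assms(2)
  by (induction I rule: infinite_finite_induct) (auto intro: Ck_on_const Ck_on_add[OF assms(1)])

text \<open>
  The exponent is arbitrary because differentiation lowers it by one, so that the induction has to
  cover all exponents at once.
\<close>

lemma Ck_on_powr:
  fixes h :: "'a::euclidean_space \<Rightarrow> real"
  assumes "open U" "Ck_on k U h" "\<And>x. x \<in> U \<Longrightarrow> h x > 0"
  shows "Ck_on k U (\<lambda>x. h x powr a)"
  using assms(2)
proof (induction k arbitrary: a)
  case 0
  then show ?case using assms(3) by (auto intro!: continuous_intros dest!: assms(3))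
next
  case (Suc k)
  show ?case
  proof (rule Ck_on_SucI[OF assms(1)])
    fix x assume x: "x \<in> U"
    have "((\<lambda>s. s powr a) has_real_derivative a * h x powr (a - 1)) (at (h x))"
      using assms(3)[OF x] by (rule has_real_derivative_powr)
    from has_derivative_compose[OF Ck_on_has_derivative[OF Suc.prems x]
        this[unfolded has_field_derivative_def]]
    show "((\<lambda>x. h x powr a) has_derivative
        (\<lambda>v. a * h x powr (a - 1) * frechet_derivative h (at x) v)) (at x)" .
  next
    fix v
    show "Ck_on k U (\<lambda>x. a * h x powr (a - 1) * frechet_derivative h (at x) v)"
      using Suc.prems Ck_on_SucD[OF Suc.prems]
      by (intro Ck_on_mult[OF assms(1)] Suc.IH Ck_on_const) auto
  qed
qed

section \<open>Calculus on open subsets of the sphere\<close>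

lemma open_in_sphere_norm: "open_in_sphere W \<Longrightarrow> x \<in> W \<Longrightarrow> norm x = 1"
  unfolding open_in_sphere_def by (meson openin_imp_subset mem_sphere_0 subsetD)

text \<open>
  A curve on the sphere has velocity orthogonal to its position because \<open>z t \<bullet> z t\<close> is constant;
  conversely, normalising the line \<open>x + t *\<^sub>R h\<close> gives a curve with velocity \<open>h\<close>. The existence
  of these curves is what makes gradients on \<open>W\<close> unique and tangent spaces of mirrors full
  hyperplanes.
\<close>

lemma tangent_space_open_in_sphere:
  fixes x :: "'a::euclidean_space"
  assumes "open_in_sphere W" "x \<in> W"
  shows "tangent_space W x = {h. h \<bullet> x = 0}"
proof (intro set_eqI iffI)
  fix h assume "h \<in> tangent_space W x"
  then obtain z e where e: "0 < e" "z ` {-e<..<e} \<subseteq> W" "z 0 = x"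
    "(z has_vector_derivative h) (at (0::real))"
    unfolding tangent_space_def by auto
  have one: "z t \<bullet> z t = 1" if "t \<in> {-e<..<e}" for t
    using open_in_sphere_norm[OF assms(1), of "z t"] e(2) that
    by (auto simp: dot_square_norm image_subset_iff)
  have "((\<lambda>t. z t \<bullet> z t) has_derivative (\<lambda>s. z 0 \<bullet> (s *\<^sub>R h) + (s *\<^sub>R h) \<bullet> z 0)) (at 0)"
    using e(4) unfolding has_vector_derivative_def by (intro has_derivative_inner)
  moreover have "((\<lambda>t. z t \<bullet> z t) has_derivative (\<lambda>s. 0)) (at 0)"
    by (rule has_derivative_transform_within_open[of "\<lambda>_. 1" _ _ _ "{-e<..<e}"])
       (use one e(1) in auto)
  ultimately have "(\<lambda>s::real. z 0 \<bullet> (s *\<^sub>R h) + (s *\<^sub>R h) \<bullet> z 0) = (\<lambda>s. 0)"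
    by (rule has_derivative_unique)
  from fun_cong[OF this, of 1] show "h \<in> {h. h \<bullet> x = 0}"
    using e(3) by (simp add: inner_commute)
next
  fix h assume "h \<in> {h. h \<bullet> x = 0}"
  then have h: "h \<bullet> x = 0" "x \<bullet> h = 0" by (auto simp: inner_commute)
  have nx: "x \<bullet> x = 1" using open_in_sphere_norm[OF assms] by (simp add: dot_square_norm)
  \<comment> \<open>The radicand is the squared norm of \<open>x + t *\<^sub>R h\<close>.\<close>
  define z where "z = (\<lambda>t::real. (1 / sqrt (1 + t\<^sup>2 * (h \<bullet> h))) *\<^sub>R (x + t *\<^sub>R h))"
  have pos: "1 + t\<^sup>2 * (h \<bullet> h) > 0" for t :: real
    by (simp add: add_pos_nonneg)
  have "((\<lambda>t. 1 / sqrt (1 + t\<^sup>2 * (h \<bullet> h))) has_real_derivative 0) (at 0)"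
    by (auto intro!: derivative_eq_intros)
  moreover have "((\<lambda>t. x + t *\<^sub>R h) has_vector_derivative h) (at (0::real))"
    by (auto intro!: derivative_eq_intros)
  ultimately have dz: "(z has_vector_derivative h) (at 0)"
    unfolding z_def using has_vector_derivative_scaleR by fastforce
  have "z t \<bullet> z t = 1" for t
    using pos[of t] h nx
    by (simp add: z_def inner_add_left inner_add_right field_simps power2_eq_square)
  then have sph: "z t \<in> sphere 0 1" for t
    by (simp add: norm_eq_1)
  have cont: "continuous_on UNIV z"
    unfolding z_def by (intro continuous_intros) (metis pos less_irrefl real_sqrt_eq_zero_cancel_iff)
  obtain O' where O': "open O'" "W = sphere 0 1 \<inter> O'"
    using assms(1) unfolding open_in_sphere_def openin_open by auto
  have z0: "z 0 = x" by (simp add: z_def)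
  have "open (z -` O')" using cont O'(1) by (simp add: open_vimage)
  moreover have "0 \<in> z -` O'" using z0 O' assms(2) by auto
  ultimately obtain e where "e > 0" "ball 0 e \<subseteq> z -` O'" by (meson openE)
  then have "z ` {-e<..<e} \<subseteq> W" using sph O'(2) by (auto simp: ball_def dist_norm subset_iff)
  then show "h \<in> tangent_space W x"
    unfolding tangent_space_def using \<open>e > 0\<close> z0 dz by blast
qed

lemma has_vector_derivative_along_curve:
  fixes f :: "'a::euclidean_space \<Rightarrow> real"
  assumes "0 < e" "z ` {-e<..<e} \<subseteq> W" "(z has_vector_derivative h) (at (0::real))"
    and "(f has_derivative (\<lambda>h. G \<bullet> h)) (at (z 0) within W)"
  shows "((\<lambda>t. f (z t)) has_real_derivative G \<bullet> h) (at 0)"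
proof -
  have "(z has_derivative (\<lambda>s. s *\<^sub>R h)) (at 0 within {-e<..<e})"
    using assms(3) has_derivative_at_withinI unfolding has_vector_derivative_def by blast
  from has_derivative_in_compose[OF this has_derivative_subset[OF assms(4,2)]]
  have "((\<lambda>t. f (z t)) has_derivative (\<lambda>s. G \<bullet> (s *\<^sub>R h))) (at 0 within {-e<..<e})" .
  moreover have "at (0::real) within {-e<..<e} = at 0"
    using assms(1) by (intro at_within_open) auto
  moreover have "(\<lambda>s. G \<bullet> (s *\<^sub>R h)) = (*) (G \<bullet> h)" by auto
  ultimately show ?thesis unfolding has_field_derivative_def by metis
qed

text \<open>
  The difference of two candidates for the gradient is itself tangent to the sphere. Differentiating
  \<open>F\<close> along a curve with this very velocity shows that the difference is orthogonal to itself.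
\<close>

lemma sphere_gradient_eqI:
  fixes x :: "'a::euclidean_space"
  assumes "open_in_sphere W" "x \<in> W"
    and "G \<bullet> x = 0" "(F has_derivative (\<lambda>h. G \<bullet> h)) (at x within W)"
  shows "sphere_gradient W F x = G"
  unfolding sphere_gradient_def
proof (rule the_equality)
  fix G' assume G': "G' \<bullet> x = 0 \<and> (F has_derivative (\<lambda>h. G' \<bullet> h)) (at x within W)"
  have "G' - G \<in> tangent_space W x"
    unfolding tangent_space_open_in_sphere[OF assms(1,2)] using G' assms(3)
    by (simp add: inner_diff_left)
  then obtain z e where z: "0 < e" "z ` {-e<..<e} \<subseteq> W" "z 0 = x"
    "(z has_vector_derivative (G' - G)) (at (0::real))"
    unfolding tangent_space_def by auto
  have "G' \<bullet> (G' - G) = G \<bullet> (G' - G)"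
    using has_vector_derivative_along_curve[OF z(1,2,4)] G' assms(4) z(3) DERIV_unique by metis
  then have "(G' - G) \<bullet> (G' - G) = 0" by (simp add: inner_diff_left)
  then show "G' = G" by simp
qed (use assms in auto)

text \<open>
  The spherical gradient is the tangential part of the ambient gradient \<open>A\<close> of a local extension.
  The explicit formula for its squared norm, in terms of the partial derivatives \<open>D b\<close>, is what
  carries over the smoothness of the extension.
\<close>

lemma sphere_gradient_of_extension:
  fixes F f :: "'a::euclidean_space \<Rightarrow> real"
  assumes "open_in_sphere W" "x \<in> W"
    and U: "open U" "x \<in> U" "\<And>z. z \<in> W \<inter> U \<Longrightarrow> F z = f z"
    and F: "(F has_derivative D) (at x)"
  defines "A \<equiv> \<Sum>b\<in>Basis. D b *\<^sub>R b"
  shows "sphere_gradient W f x = A - (A \<bullet> x) *\<^sub>R x"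
    and "(f has_derivative (\<lambda>h. (A - (A \<bullet> x) *\<^sub>R x) \<bullet> h)) (at x within W)"
    and "(A - (A \<bullet> x) *\<^sub>R x) \<bullet> x = 0"
    and "(norm (A - (A \<bullet> x) *\<^sub>R x))\<^sup>2 = (\<Sum>b\<in>Basis. D b * D b) - (\<Sum>b\<in>Basis. D b * (x \<bullet> b))\<^sup>2"
proof -
  have nx: "x \<bullet> x = 1" using open_in_sphere_norm[OF assms(1,2)] by (simp add: dot_square_norm)
  have D: "D h = A \<bullet> h" for h
  proof -
    have "D h = D (\<Sum>b\<in>Basis. (h \<bullet> b) *\<^sub>R b)" by (simp add: euclidean_representation)
    also have "\<dots> = (\<Sum>b\<in>Basis. (h \<bullet> b) * D b)"
      using has_derivative_linear[OF F] by (simp add: linear_sum linear_cmul)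
    finally show ?thesis
      by (simp add: A_def inner_sum_left inner_commute[of h] mult.commute)
  qed
  \<comment> \<open>Subtracting a multiple of \<open>z \<bullet> z - 1\<close>, which vanishes on the sphere, removes the radial
     component of the gradient.\<close>
  define k where "k = A \<bullet> x"
  have "((\<lambda>z. F z - k / 2 * (z \<bullet> z - 1)) has_derivative (\<lambda>h. D h - k / 2 * (x \<bullet> h + h \<bullet> x)))
      (at x within W)"
    by (rule derivative_eq_intros has_derivative_at_withinI[OF F] refl | simp)+
  moreover have "(\<lambda>h. D h - k / 2 * (x \<bullet> h + h \<bullet> x)) = (\<lambda>h. (A - k *\<^sub>R x) \<bullet> h)"
    by (auto simp: D inner_diff_left inner_commute[of x])
  ultimately have d: "((\<lambda>z. F z - k / 2 * (z \<bullet> z - 1)) has_derivative (\<lambda>h. (A - k *\<^sub>R x) \<bullet> h))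
      (at x within W)" by metis
  obtain e where e: "e > 0" "ball x e \<subseteq> U" using U openE by blast
  show der: "(f has_derivative (\<lambda>h. (A - (A \<bullet> x) *\<^sub>R x) \<bullet> h)) (at x within W)"
    unfolding k_def[symmetric]
  proof (rule has_derivative_transform_within[OF d e(1) assms(2)])
    fix z assume "z \<in> W" "dist z x < e"
    then have "z \<in> W \<inter> U" using e(2) by (auto simp: dist_commute)
    moreover have "z \<bullet> z = 1"
      using open_in_sphere_norm[OF assms(1) \<open>z \<in> W\<close>] by (simp add: dot_square_norm)
    ultimately show "F z - k / 2 * (z \<bullet> z - 1) = f z" using U(3) by simp
  qed
  show perp: "(A - (A \<bullet> x) *\<^sub>R x) \<bullet> x = 0" by (simp add: inner_diff_left nx)
  show "sphere_gradient W f x = A - (A \<bullet> x) *\<^sub>R x"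
    by (rule sphere_gradient_eqI[OF assms(1,2) perp der])
  have "A \<bullet> A = (\<Sum>b\<in>Basis. D b * D b)"
    by (subst (2) A_def) (simp add: inner_sum_right flip: D)
  moreover have "A \<bullet> x = (\<Sum>b\<in>Basis. D b * (x \<bullet> b))"
    by (simp add: A_def inner_sum_left inner_commute[of x])
  moreover have "(norm (A - (A \<bullet> x) *\<^sub>R x))\<^sup>2 = A \<bullet> A - (A \<bullet> x)\<^sup>2"
    unfolding power2_norm_eq_inner
    by (simp add: inner_diff_left inner_diff_right nx inner_commute power2_eq_square)
  ultimately show
    "(norm (A - (A \<bullet> x) *\<^sub>R x))\<^sup>2 = (\<Sum>b\<in>Basis. D b * D b) - (\<Sum>b\<in>Basis. D b * (x \<bullet> b))\<^sup>2"
    by simp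
qed

lemma smooth_map_on_extension:
  fixes f :: "'a::euclidean_space \<Rightarrow> 'b::real_normed_vector"
  assumes "smooth_map_on W f" "x \<in> W"
  obtains U F where "open U" "x \<in> U" "\<And>k. Ck_on k U F" "\<And>z. z \<in> W \<inter> U \<Longrightarrow> F z = f z"
    "\<And>z. z \<in> U \<Longrightarrow> (F has_derivative frechet_derivative F (at z)) (at z)"
proof -
  obtain U F where *: "open U" "x \<in> U" "\<And>k. Ck_on k U F" "\<And>z. z \<in> W \<inter> U \<Longrightarrow> F z = f z"
    using assms unfolding smooth_map_on_def smooth_on_def by metis
  show thesis by (rule that[OF *]) (use Ck_on_has_derivative[OF *(3)[of "Suc 0"]] in auto)
qed

lemma sphere_gradient_works:
  fixes f :: "'a::euclidean_space \<Rightarrow> real"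
  assumes "open_in_sphere W" "smooth_map_on W f" "x \<in> W"
  shows "sphere_gradient W f x \<bullet> x = 0"
    and "(f has_derivative (\<lambda>h. sphere_gradient W f x \<bullet> h)) (at x within W)"
proof -
  obtain U F where UF: "open U" "x \<in> U" "\<And>k. Ck_on k U F" "\<And>z. z \<in> W \<inter> U \<Longrightarrow> F z = f z"
    "\<And>z. z \<in> U \<Longrightarrow> (F has_derivative frechet_derivative F (at z)) (at z)"
    using smooth_map_on_extension[OF assms(2,3)] by blast
  note ext = sphere_gradient_of_extension[OF assms(1,3) UF(1,2,4) UF(5)[OF UF(2)]]
  show "sphere_gradient W f x \<bullet> x = 0" using ext(1,3) by simp
  show "(f has_derivative (\<lambda>h. sphere_gradient W f x \<bullet> h)) (at x within W)" using ext(1,2) by simp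
qed

text \<open>
  Near each point, \<open>(norm G)\<^sup>2\<close> for the spherical gradient \<open>G\<close> extends to a smooth function \<open>N\<close> on an
  open subset of the ambient space. The extension of \<open>1 / norm G\<close> is \<open>N powr (-1/2)\<close>, restricted to
  the open set on which \<open>N\<close> is positive.
\<close>

lemma smooth_map_on_inverse_norm_gradient:
  fixes f :: "'a::euclidean_space \<Rightarrow> real"
  assumes "open_in_sphere W" "smooth_map_on W f"
    and "\<And>x. x \<in> W \<Longrightarrow> sphere_gradient W f x \<noteq> 0"
  shows "smooth_map_on W (\<lambda>x. 1 / norm (sphere_gradient W f x))"
  unfolding smooth_map_on_def
proof
  fix x assume x: "x \<in> W"
  obtain U F where UF: "open U" "x \<in> U" "\<And>k. Ck_on k U F" "\<And>z. z \<in> W \<inter> U \<Longrightarrow> F z = f z"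
    "\<And>z. z \<in> U \<Longrightarrow> (F has_derivative frechet_derivative F (at z)) (at z)"
    using smooth_map_on_extension[OF assms(2) x] by blast
  define N where "N z = (\<Sum>b\<in>Basis. frechet_derivative F (at z) b * frechet_derivative F (at z) b)
     + (-1) * ((\<Sum>b\<in>Basis. frechet_derivative F (at z) b * (z \<bullet> b)) *
        (\<Sum>b\<in>Basis. frechet_derivative F (at z) b * (z \<bullet> b)))" for z
  have D: "Ck_on k U (\<lambda>z. frechet_derivative F (at z) b)" for k b
    using UF(3)[of "Suc k"] by simp
  have N: "Ck_on k U N" for k
    unfolding N_def
    by (intro Ck_on_add Ck_on_mult Ck_on_sum Ck_on_const D UF(1) Ck_on_bounded_linear
        bounded_linear_inner_left)
  have Neq: "N z = (norm (sphere_gradient W f z))\<^sup>2" if "z \<in> W \<inter> U" for z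
    using sphere_gradient_of_extension(1,4)[OF assms(1) _ UF(1) _ UF(4) UF(5), of z] that
    by (simp add: N_def power2_eq_square)
  define V where "V = {z \<in> U. N z > 0}"
  have "continuous_on U N" using N[of 0] by simp
  then have "open (U \<inter> N -` {0<..})"
    using UF(1) by (intro continuous_open_preimage) auto
  moreover have "U \<inter> N -` {0<..} = V" by (auto simp: V_def)
  ultimately have V: "open V" "V \<subseteq> U" by (auto simp: V_def)
  have "x \<in> V" using UF(2) x Neq[of x] assms(3)[OF x] by (simp add: V_def)
  moreover have "smooth_on V (\<lambda>z. N z powr (-1/2))"
    unfolding smooth_on_def
    by (intro allI Ck_on_powr V Ck_on_subset[OF N V(2)]) (simp add: V_def)
  moreover have "N z powr (-1/2) = 1 / norm (sphere_gradient W f z)" if "z \<in> W \<inter> V" for z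
    using that V(2) Neq[of z] assms(3)[of z]
    by (auto simp: powr_minus_divide powr_half_sqrt)
  ultimately show "\<exists>U F. open U \<and> x \<in> U \<and> smooth_on U F \<and>
      (\<forall>z\<in>W \<inter> U. F z = 1 / norm (sphere_gradient W f z))"
    using V(1) by blast
qed

section \<open>Reflection in a mirror given by a radial function\<close>

lemma reflect_across_hyperplane:
  fixes N :: "'a::euclidean_space"
  assumes "N \<noteq> 0"
  shows "reflect_across {v. N \<bullet> v = 0} a = a - (2 * (N \<bullet> a) / (N \<bullet> N)) *\<^sub>R N"
proof -
  let ?p = "a - ((N \<bullet> a) / (N \<bullet> N)) *\<^sub>R N"
  have p: "N \<bullet> ?p = 0" using assms by (simp add: inner_diff_right)
  have proj: "?p = closest_point {v. N \<bullet> v = 0} a"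
  proof (rule closest_point_unique[OF convex_hyperplane closed_hyperplane])
    show "\<forall>z\<in>{v. N \<bullet> v = 0}. dist a ?p \<le> dist a z"
    proof
      fix z assume "z \<in> {v. N \<bullet> v = 0}"
      then have "orthogonal (a - ?p) (?p - z)"
        using p by (simp add: orthogonal_def inner_diff_right)
      from norm_add_Pythagorean[OF this]
      have "(norm (a - ?p))\<^sup>2 \<le> (norm (a - z))\<^sup>2" by (simp add: algebra_simps)
      then show "dist a ?p \<le> dist a z"
        unfolding dist_norm by (rule power2_le_imp_le) simp
    qed
  qed (use p in simp)
  show ?thesis unfolding reflect_across_def proj[symmetric] by (simp add: scaleR_2 algebra_simps)
qed

text \<open>
  Curves in the mirror and curves in \<open>W\<close> correspond to each other by radial projection. A curve in \<open>W\<close>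
  through \<open>x\<close> with velocity \<open>h\<close>, which is any vector orthogonal to \<open>x\<close>, lifts to a curve in the mirror
  with velocity \<open>exp (f x) *\<^sub>R (h + (G \<bullet> h) *\<^sub>R x)\<close>. These vectors are exactly those whose inner
  products with \<open>x\<close> and with \<open>G\<close> agree.
\<close>

lemma tangent_space_radial_mirror:
  fixes x :: "'a::euclidean_space"
  assumes W: "open_in_sphere W" "x \<in> W"
    and G: "G \<bullet> x = 0" "(f has_derivative (\<lambda>h. G \<bullet> h)) (at x within W)"
  shows "tangent_space (mirror_point f ` W) (mirror_point f x) = {v. (x - G) \<bullet> v = 0}"
proof -
  have nx: "x \<bullet> x = 1" using open_in_sphere_norm[OF W] by (simp add: dot_square_norm)
  have lift: "((\<lambda>t. mirror_point f (z t)) has_vector_derivative exp (f x) *\<^sub>R (h + (G \<bullet> h) *\<^sub>R x)) (at 0)"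
    if z: "0 < e" "z ` {-e<..<e} \<subseteq> W" "z 0 = x" "(z has_vector_derivative h) (at (0::real))"
    for z e h
  proof -
    have "((\<lambda>t. f (z t)) has_real_derivative G \<bullet> h) (at 0)"
      using has_vector_derivative_along_curve[OF z(1,2,4)] G(2) z(3) by simp
    from has_vector_derivative_scaleR[OF DERIV_chain2[OF DERIV_exp this] z(4)] show ?thesis
      unfolding mirror_point_def using z(3) by (simp add: algebra_simps)
  qed
  show ?thesis
  proof (intro set_eqI iffI)
    fix v assume "v \<in> tangent_space (mirror_point f ` W) (mirror_point f x)"
    then obtain \<gamma> e where g: "0 < e" "\<gamma> ` {-e<..<e} \<subseteq> mirror_point f ` W"
      "\<gamma> 0 = mirror_point f x" "(\<gamma> has_vector_derivative v) (at (0::real))"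
      unfolding tangent_space_def by auto
    \<comment> \<open>The radial projection of the curve back to the sphere.\<close>
    define z where "z t = (1 / norm (\<gamma> t)) *\<^sub>R \<gamma> t" for t
    have z: "z t \<in> W \<and> mirror_point f (z t) = \<gamma> t" if t: "t \<in> {-e<..<e}" for t
    proof -
      obtain w where "w \<in> W" "\<gamma> t = mirror_point f w" using g(2) t by blast
      moreover from this have "z t = w"
        using open_in_sphere_norm[OF W(1)] by (simp add: z_def mirror_point_def)
      ultimately show ?thesis by simp
    qed
    have z0: "z 0 = x" using open_in_sphere_norm[OF W] g(3) by (simp add: z_def mirror_point_def)
    have "\<gamma> 0 \<noteq> 0" using g(3) nx by (auto simp: mirror_point_def)
    from has_derivative_compose[OF g(4)[unfolded has_vector_derivative_def] has_derivative_norm[OF this]]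
    have "(\<lambda>t. norm (\<gamma> t)) differentiable (at 0)"
      unfolding differentiable_def by blast
    then have "z differentiable (at 0)"
      unfolding z_def using \<open>\<gamma> 0 \<noteq> 0\<close> differentiableI_vector[OF g(4)]
      by (intro differentiable_scaleR differentiable_divide) auto
    then obtain h where h: "(z has_vector_derivative h) (at 0)"
      using vector_derivative_works by blast
    have zW: "z ` {-e<..<e} \<subseteq> W" using z by auto
    then have "h \<in> tangent_space W x"
      unfolding tangent_space_def using g(1) z0 h by blast
    then have hx: "h \<bullet> x = 0" using tangent_space_open_in_sphere[OF W] by simp
    have "(\<gamma> has_vector_derivative exp (f x) *\<^sub>R (h + (G \<bullet> h) *\<^sub>R x)) (at 0)"
      by (rule has_vector_derivative_transform_within_open[OF lift[OF g(1) zW z0 h],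
            of "{-e<..<e}"]) (use g(1) z in auto)
    then have "v = exp (f x) *\<^sub>R (h + (G \<bullet> h) *\<^sub>R x)"
      using g(4) vector_derivative_unique_at by blast
    then show "v \<in> {v. (x - G) \<bullet> v = 0}"
      using hx nx G(1) by (simp add: inner_diff_left inner_add_right inner_commute[of x h])
  next
    fix v assume "v \<in> {v. (x - G) \<bullet> v = 0}"
    then have v: "G \<bullet> v = x \<bullet> v" by (simp add: inner_diff_left)
    \<comment> \<open>The tangential part of \<open>v\<close>, scaled so that the lift of a curve with velocity \<open>h\<close> has velocity \<open>v\<close>.\<close>
    define h where "h = exp (- f x) *\<^sub>R (v - (x \<bullet> v) *\<^sub>R x)"
    have "h \<in> tangent_space W x"
      unfolding tangent_space_open_in_sphere[OF W]
      by (simp add: h_def inner_diff_left nx inner_commute[of v])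
    then obtain z e where z: "0 < e" "z ` {-e<..<e} \<subseteq> W" "z 0 = x"
      "(z has_vector_derivative h) (at (0::real))"
      unfolding tangent_space_def by auto
    have "exp (f x) *\<^sub>R (h + (G \<bullet> h) *\<^sub>R x) = v"
      using G(1) v by (simp add: h_def inner_diff_right algebra_simps flip: exp_add)
    then have "((\<lambda>t. mirror_point f (z t)) has_vector_derivative v) (at 0)"
      using lift[OF z] by simp
    moreover have "(\<lambda>t. mirror_point f (z t)) ` {-e<..<e} \<subseteq> mirror_point f ` W"
      using z(2) by auto
    ultimately show "v \<in> tangent_space (mirror_point f ` W) (mirror_point f x)"
      unfolding tangent_space_def using z(1,3) by blast
  qed
qed

lemma reflect_across_radial_mirror:
  fixes x :: "'a::euclidean_space"
  assumes W: "open_in_sphere W" "x \<in> W" and f: "smooth_map_on W f"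
  defines "G \<equiv> sphere_gradient W f x"
  shows "reflect_across (tangent_space (mirror_point f ` W) (mirror_point f x)) x
    = x - (2 / (1 + G \<bullet> G)) *\<^sub>R (x - G)"
proof -
  note G = sphere_gradient_works[OF W(1) f W(2), folded G_def]
  have nx: "x \<bullet> x = 1" using open_in_sphere_norm[OF W] by (simp add: dot_square_norm)
  have 1: "(x - G) \<bullet> x = 1" "(x - G) \<bullet> (x - G) = 1 + G \<bullet> G"
    using G(1) nx by (simp_all add: inner_diff_left inner_diff_right inner_commute)
  then have "x - G \<noteq> 0" by auto
  from reflect_across_hyperplane[OF this] show ?thesis
    unfolding tangent_space_radial_mirror[OF W G] 1 by (simp add: 1)
qed

text \<open>
  The normal \<open>x - G\<close> has inner product \<open>1\<close> with \<open>x\<close>, so the radial direction is not tangent to the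
  mirror, and the reflection moves every nonzero vector on the radial line. The case \<open>- x\<close> serves
  for the second mirror, which the ray hits on its way towards the origin.
\<close>

lemma reflect_across_radial_mirror_neq:
  fixes x :: "'a::euclidean_space"
  assumes W: "open_in_sphere W" "x \<in> W" and f: "smooth_map_on W f"
  shows "reflect_across (tangent_space (mirror_point f ` W) (mirror_point f x)) x \<noteq> x"
    and "reflect_across (tangent_space (mirror_point f ` W) (mirror_point f x)) (- x) \<noteq> - x"
proof -
  define G where "G = sphere_gradient W f x"
  note G = sphere_gradient_works[OF W(1) f W(2), folded G_def]
  have nx: "x \<bullet> x = 1" using open_in_sphere_norm[OF W] by (simp add: dot_square_norm)
  have 1: "(x - G) \<bullet> x = 1"
    using G(1) nx by (simp add: inner_diff_left)
  then have "x - G \<noteq> 0" by auto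
  note refl = reflect_across_hyperplane[OF this, folded tangent_space_radial_mirror[OF W G]]
  show "reflect_across (tangent_space (mirror_point f ` W) (mirror_point f x)) x \<noteq> x"
    "reflect_across (tangent_space (mirror_point f ` W) (mirror_point f x)) (- x) \<noteq> - x"
    using \<open>x - G \<noteq> 0\<close> 1 unfolding refl by auto
qed

section \<open>The direction field of a spherical periscope\<close>

lemma orthogonal_part_nonzero:
  fixes x y :: "'a::real_inner"
  assumes "norm x = 1" "norm y = 1" "y \<noteq> x" "y \<noteq> - x"
  shows "y - (y \<bullet> x) *\<^sub>R x \<noteq> 0"
proof
  assume "y - (y \<bullet> x) *\<^sub>R x = 0"
  then have *: "y = (y \<bullet> x) *\<^sub>R x" by simp
  then have "\<bar>y \<bullet> x\<bar> = 1" using assms(1,2) by (metis norm_scaleR mult.right_neutral)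
  then consider "y \<bullet> x = 1" | "y \<bullet> x = -1" by linarith
  then show False using * assms(3,4) by cases simp_all
qed

text \<open>
  In \<open>T x = cos t *\<^sub>R x + sin t *\<^sub>R v\<close> the part orthogonal to \<open>x\<close> is \<open>sin t *\<^sub>R v\<close>, and \<open>sin t\<close> is positive
  on \<open>{0<..<pi}\<close>; this determines \<open>v\<close>. For existence, \<open>t\<close> is the angle between \<open>x\<close> and \<open>T x\<close>.
\<close>

lemma geodesic_direction_eq_sgn:
  fixes x :: "'a::euclidean_space"
  assumes "norm x = 1" "norm (T x) = 1" "T x \<noteq> x" "T x \<noteq> - x"
  shows "geodesic_direction T x = sgn (T x - (T x \<bullet> x) *\<^sub>R x)"
proof -
  let ?y = "T x" let ?c = "?y \<bullet> x" let ?w = "?y - ?c *\<^sub>R x"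
  have n: "x \<bullet> x = 1" "?y \<bullet> ?y = 1" using assms by (simp_all add: dot_square_norm)
  have wx: "?w \<bullet> x = 0" using n by (simp add: inner_diff_left)
  have ww: "(norm ?w)\<^sup>2 = 1 - ?c\<^sup>2"
    unfolding power2_norm_eq_inner using n
    by (simp add: inner_diff_left inner_diff_right inner_commute power2_eq_square)
  note w0 = orthogonal_part_nonzero[OF assms]
  have "?c\<^sup>2 < 1" using ww w0 by (metis diff_gt_0_iff_gt zero_less_norm_iff zero_less_power)
  then have c: "-1 < ?c" "?c < 1" using abs_square_less_1[of ?c] by auto
  define t where "t = arccos ?c"
  have t: "t \<in> {0<..<pi}" "cos t = ?c" "sin t = norm ?w"
    using c arccos_lt_bounded[of ?c] ww by (auto simp: t_def sin_arccos real_sqrt_unique simp flip: ww)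
  show ?thesis unfolding geodesic_direction_def
  proof (rule the_equality)
    have "?y = cos t *\<^sub>R x + sin t *\<^sub>R sgn ?w"
      using w0 by (simp add: t sgn_div_norm)
    then show "norm (sgn ?w) = 1 \<and> sgn ?w \<bullet> x = 0 \<and>
        (\<exists>t\<in>{0<..<pi}. ?y = cos t *\<^sub>R x + sin t *\<^sub>R sgn ?w)"
      using w0 wx t(1) by (auto simp: norm_sgn sgn_div_norm)
  next
    fix v assume v: "norm v = 1 \<and> v \<bullet> x = 0 \<and>
        (\<exists>t\<in>{0<..<pi}. ?y = cos t *\<^sub>R x + sin t *\<^sub>R v)"
    then obtain s where s: "s \<in> {0<..<pi}" "?y = cos s *\<^sub>R x + sin s *\<^sub>R v" by blast
    have "?c = cos s" unfolding s(2) using v n(1) by (simp add: inner_add_left)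
    then have "?w = sin s *\<^sub>R v" using s(2) by (metis add_diff_cancel_left')
    moreover have "sin s > 0" using s(1) sin_gt_zero by auto
    ultimately show "v = sgn ?w" using v by (simp add: sgn_scaleR sgn_div_norm)
  qed
qed

text \<open>
  The component of \<open>u\<close> orthogonal to \<open>x\<close> is computed twice: from the law of reflection it is a positive
  multiple of the gradient, and from \<open>u = (Q - P) /\<^sub>R norm (Q - P)\<close> a positive multiple of the
  component of \<open>T x\<close> orthogonal to \<open>x\<close>.
\<close>

lemma geodesic_direction_eq_sgn_gradient:
  fixes x :: "'a::euclidean_space"
  assumes per: "spherical_periscope W T f g" and x: "x \<in> W" and anti: "T x \<noteq> - x"
  shows "sphere_gradient W f x \<noteq> 0"
    and "geodesic_direction T x = sgn (sphere_gradient W f x)"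
proof -
  define P Q u where "P = mirror_point f x" and "Q = mirror_point g (T x)"
    and "u = (Q - P) /\<^sub>R norm (Q - P)"
  have W: "open_in_sphere W" "open_in_sphere (T ` W)" "smooth_map_on W f" "smooth_map_on (T ` W) g"
    using per unfolding spherical_periscope_def sphere_diffeo_def by auto
  have PQ: "P \<noteq> Q"
    and u1: "u = reflect_across (tangent_space (mirror_point f ` W) P) x"
    and u2: "- T x = reflect_across (tangent_space (mirror_point g ` T ` W) Q) u"
    using per x unfolding spherical_periscope_def Let_def P_def Q_def u_def by auto
  have Tx: "T x \<in> T ` W" using x by auto
  have nx: "norm x = 1" "norm (T x) = 1"
    using open_in_sphere_norm W x Tx by auto
  then have xx: "x \<bullet> x = 1" by (simp add: dot_square_norm)
  have nu: "norm u = 1" using PQ by (simp add: u_def)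
  \<comment> \<open>Otherwise \<open>u\<close> is radial and is fixed by one of the two reflections.\<close>
  have neq: "T x \<noteq> x"
  proof
    assume eq: "T x = x"
    have "Q - P = (exp (g x) - exp (f x)) *\<^sub>R x"
      by (simp add: P_def Q_def eq mirror_point_def algebra_simps)
    then obtain a where a: "u = a *\<^sub>R x" by (metis u_def scaleR_scaleR)
    then have "\<bar>a\<bar> = 1" using nu nx by simp
    then consider "u = x" | "u = - x" using a by (metis abs_eq_iff abs_one scaleR_minus1_left scaleR_one)
    then show False
    proof cases
      case 1
      then show False
        using u1 reflect_across_radial_mirror_neq(1)[OF W(1) x W(3)] by (simp add: P_def)
    next
      case 2
      then show False
        using u2 eq reflect_across_radial_mirror_neq(2)[OF W(2) Tx W(4)] by (simp add: Q_def)
    qed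
  qed
  define w where "w = T x - (T x \<bullet> x) *\<^sub>R x"
  define G where "G = sphere_gradient W f x"
  have dir: "geodesic_direction T x = sgn w"
    unfolding w_def by (rule geodesic_direction_eq_sgn) fact+
  have w0: "w \<noteq> 0" unfolding w_def by (rule orthogonal_part_nonzero) fact+
  have Gx: "G \<bullet> x = 0" using sphere_gradient_works(1)[OF W(1,3) x] by (simp add: G_def)
  have u_eq: "u = x - (2 / (1 + G \<bullet> G)) *\<^sub>R (x - G)"
    using u1 reflect_across_radial_mirror[OF W(1) x W(3)] by (simp add: P_def G_def)
  then have "u \<bullet> x = 1 - 2 / (1 + G \<bullet> G)"
    using Gx xx by (simp add: inner_diff_left)
  then have "u - (u \<bullet> x) *\<^sub>R x = x - (2 / (1 + G \<bullet> G)) *\<^sub>R (x - G) - (1 - 2 / (1 + G \<bullet> G)) *\<^sub>R x"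
    using u_eq by metis
  also have "\<dots> = (2 / (1 + G \<bullet> G)) *\<^sub>R G"
    by (simp add: algebra_simps)
  finally have "u - (u \<bullet> x) *\<^sub>R x = (2 / (1 + G \<bullet> G)) *\<^sub>R G" .
  moreover have "u - (u \<bullet> x) *\<^sub>R x = (exp (g (T x)) / norm (Q - P)) *\<^sub>R w"
    using xx by (simp add: u_def w_def Q_def P_def mirror_point_def algebra_simps inner_diff_left
        divide_inverse)
  ultimately have eq: "(2 / (1 + G \<bullet> G)) *\<^sub>R G = (exp (g (T x)) / norm (Q - P)) *\<^sub>R w" by simp
  have pos: "2 / (1 + G \<bullet> G) > 0" "exp (g (T x)) / norm (Q - P) > 0"
    using PQ by (auto intro!: divide_pos_pos add_pos_nonneg)
  show "sphere_gradient W f x \<noteq> 0" using eq pos w0 by (auto simp flip: G_def)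
  have "sgn ((2 / (1 + G \<bullet> G)) *\<^sub>R G) = sgn G"
    "sgn ((exp (g (T x)) / norm (Q - P)) *\<^sub>R w) = sgn w"
    unfolding sgn_scaleR sgn_pos[OF pos(1)] sgn_pos[OF pos(2)] by simp_all
  then show "geodesic_direction T x = sgn (sphere_gradient W f x)"
    using eq dir by (simp add: G_def)
qed

theorem theorem1:
  fixes W :: "(real ^ 'n) set"
    and T :: "real ^ 'n \<Rightarrow> real ^ 'n"
    and f g :: "real ^ 'n \<Rightarrow> real"
  assumes "CARD('n) \<ge> 2"
    and "spherical_periscope W T f g"
    and "\<And>x. x \<in> W \<Longrightarrow> T x \<noteq> - x"
  shows "projectively_gradient W (geodesic_direction T)"
proof -
  have W: "open_in_sphere W" "smooth_map_on W f"
    using assms(2) unfolding spherical_periscope_def sphere_diffeo_def by auto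
  note dir = geodesic_direction_eq_sgn_gradient[OF assms(2) _ assms(3)]
  have "smooth_map_on W (\<lambda>x. 1 / norm (sphere_gradient W f x))"
    by (rule smooth_map_on_inverse_norm_gradient[OF W]) (rule dir(1))
  moreover have "geodesic_direction T x = (1 / norm (sphere_gradient W f x)) *\<^sub>R sphere_gradient W f x"
    if "x \<in> W" for x
    using dir(2)[OF that that] by (simp add: sgn_div_norm divide_inverse)
  ultimately show ?thesis
    unfolding projectively_gradient_def using W(2) by blast
qed

end
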